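(* For every fixed integer $s \geq 4$ and all sufficiently large $n$, $$\log r_3(s,n) \leq \left(\frac{s-3}{(s-2)!}+o(1)\right)n^{s-2} \log n,$$ where $o(1)$ denotes a quantity that, for fixed $s$, tends to $0$ as $n \to \infty$.
   Context: $r_3(s,n)$ denotes the minimum $N$ such that every red-blue coloring of the unordered triples of an $N$-element set contains either a red set of size $s$ or a blue set of size $n$, where a set is called red (blue) if all triples from this set are red (blue). Here $\log$ is the natural logarithm. *)

theory Defs
  imports "HOL-Analysis.Analysis" "HOL-Library.Ramsey"
begin

text \<open>Colour \<open>0\<close> is red and colour \<open>1\<close> is blue. Choosing \<open>{..<N}\<close> as the \<open>N\<close>-element set is
  harmless by \<open>partn_lst_cong_card\<close> below, and the minimum is attained by \<open>ramsey3_attained\<close>, so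
  that \<open>LEAST\<close> is never applied to an unsatisfiable predicate.\<close>

definition ramsey3 :: "nat \<Rightarrow> nat \<Rightarrow> nat" (\<open>r\<^sub>3\<close>) where
  "r\<^sub>3 s n = (LEAST N. partn_lst {..<N} [s, n] 3)"

lemma ramsey3_attained: "partn_lst {..<r\<^sub>3 s n} [s, n] 3"
proof -
  have "\<exists>N::nat. partn_lst {..<N} [s, n] 3"
    by (rule ramsey_full)
  then show ?thesis
    unfolding ramsey3_def by (rule LeastI_ex)
qed

lemma partn_lst_cong_bij:
  assumes g: "bij_betw g A B" and A: "partn_lst A \<alpha> k"
  shows "partn_lst B \<alpha> k"
  unfolding partn_lst_def
proof
  fix f assume f: "f \<in> nsets B k \<rightarrow> {..<length \<alpha>}"
  have inj: "inj_on g A" and gA: "g ` A = B"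
    using g by (auto simp: bij_betw_def)
  have "f \<circ> (\<lambda>X. g ` X) \<in> nsets A k \<rightarrow> {..<length \<alpha>}"
    by (rule nsets_compose_image_funcset[OF f _ inj]) (use gA in auto)
  then obtain i H where i: "i < length \<alpha>" and H: "H \<in> nsets A (\<alpha> ! i)"
    and mono: "(f \<circ> (\<lambda>X. g ` X)) ` nsets H k \<subseteq> {i}"
    using A unfolding partn_lst_def monochromatic_def by blast
  have sub: "H \<subseteq> A" using H by (simp add: nsets_def)
  have injH: "inj_on g H" using inj sub by (rule inj_on_subset)
  have "g ` H \<in> nsets B (\<alpha> ! i)"
    using H gA injH by (auto simp: nsets_def card_image)
  moreover have "f ` nsets (g ` H) k \<subseteq> {i}"
  proof clarify
    fix X assume "X \<in> nsets (g ` H) k"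
    then obtain Y where "Y \<in> nsets H k" "X = g ` Y"
      using nset_image_obtains injH by blast
    then show "f X = i" using mono by auto
  qed
  ultimately show "\<exists>i<length \<alpha>. monochromatic B (\<alpha> ! i) k f i"
    using i unfolding monochromatic_def by blast
qed

lemma partn_lst_cong_card:
  assumes "finite V"
  shows "partn_lst V \<alpha> k \<longleftrightarrow> partn_lst {..<card V} \<alpha> k"
proof -
  obtain g where g: "bij_betw g V {..<card V}"
    using assms by (metis card_lessThan finite_lessThan finite_same_card_bij)
  show ?thesis
    using partn_lst_cong_bij[OF g] partn_lst_cong_bij[OF bij_betw_inv_into[OF g]] by blast
qed

end

theory Submission
  imports Defs "HOL-Library.Sublist"
begin

text \<open>Given a two-coloured complete 3-uniform hypergraph, its vertices are sorted one by one into a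
  binary tree whose nodes are words over the colours, while a set \<open>S\<close> of candidates for later
  vertices is kept. A new vertex \<open>x \<in> S\<close> starts at the root; at an occupied node \<open>q\<close> one of the two
  colours \<open>c\<close> is chosen, \<open>S\<close> is reduced to the \<open>w\<close> for which the triple \<open>{v q, x, w}\<close> has colour
  \<open>c\<close>, and \<open>x\<close> descends to \<open>q @ [c]\<close>, until it reaches a free node. Red is chosen whenever this
  keeps at least the proportion \<open>1/n\<close> of \<open>S\<close>, so a red step costs a factor \<open>n\<close> but a blue step
  only \<open>1 - 1/n\<close>. The ancestors of a node at which colour \<open>c\<close> was chosen form, together with the
  node, a set all of whose triples have colour \<open>c\<close>. Hence, if there are no red
  sets of size \<open>s\<close> and no blue sets of size \<open>n\<close>, and \<open>S\<close> is not yet exhausted, all occupied words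
  have at most \<open>s - 3\<close> red and \<open>n - 3\<close> blue letters. There are \<open>((s + n - 4) choose (s - 2)) - 1\<close> such words, and a vertex
  sorted to such a word costs at most \<open>(s - 3) ln n + O(1)\<close> in \<open>ln (card S)\<close>.\<close>

section \<open>The sorting invariant and its extension by a new leaf\<close>

text \<open>Here \<open>prefix (p @ [c]) q\<close> says that the path to \<open>q\<close> leaves
  \<open>p\<close> by colour \<open>c\<close>. The clause on \<open>S\<close> is the promise that
  makes the last clause survive insertions: the colour of a triple is settled by the upper two of
  its nodes before the third vertex is chosen.\<close>

definition colour_tree ::
    "('a set \<Rightarrow> 'c) \<Rightarrow> 'a set \<Rightarrow> 'c list set \<Rightarrow> ('c list \<Rightarrow> 'a) \<Rightarrow> 'a set \<Rightarrow> bool" where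
  "colour_tree f V T v S \<longleftrightarrow>
     (\<forall>p\<in>T. \<forall>q. strict_prefix q p \<longrightarrow> q \<in> T) \<and>
     inj_on v T \<and> v ` T \<subseteq> V \<and> S \<subseteq> V \<and> S \<inter> v ` T = {} \<and>
     (\<forall>p\<in>T. \<forall>q\<in>T. \<forall>c. \<forall>w\<in>S. prefix (p @ [c]) q \<longrightarrow> f {v p, v q, w} = c) \<and>
     (\<forall>p\<in>T. \<forall>q\<in>T. \<forall>u\<in>T. \<forall>c. prefix (p @ [c]) q \<longrightarrow> strict_prefix q u \<longrightarrow> f {v p, v q, v u} = c)"

lemma colour_treeD:
  assumes "colour_tree f V T v S"
  shows colour_tree_closed: "p \<in> T \<Longrightarrow> strict_prefix q p \<Longrightarrow> q \<in> T"
    and colour_tree_inj: "inj_on v T"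
    and colour_tree_subset: "v ` T \<subseteq> V" "S \<subseteq> V"
    and colour_tree_disjoint: "S \<inter> v ` T = {}"
    and colour_tree_candidate: "p \<in> T \<Longrightarrow> q \<in> T \<Longrightarrow> w \<in> S \<Longrightarrow> prefix (p @ [c]) q \<Longrightarrow> f {v p, v q, w} = c"
    and colour_tree_triple: "p \<in> T \<Longrightarrow> q \<in> T \<Longrightarrow> u \<in> T \<Longrightarrow> prefix (p @ [c]) q \<Longrightarrow> strict_prefix q u \<Longrightarrow>
      f {v p, v q, v u} = c"
  using assms by (simp_all add: colour_tree_def)

lemma strict_prefix_if_snoc_prefix: "prefix (q @ [c]) p \<Longrightarrow> strict_prefix q p"
  by (auto simp: strict_prefix_def prefix_def)

text \<open>As \<open>T\<close> is closed under prefixes and \<open>p\<close> is free,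
  \<open>p\<close> becomes a leaf. In a triple along a branch \<open>x\<close> can thus only be the
  lowest vertex, and the colour is the one promised for \<open>x\<close> as a candidate. The
  promises for pairs with \<open>p\<close> as the lower node are \<open>col\<close>.\<close>

lemma colour_tree_insert:
  assumes tree: "colour_tree f V T v S" and x: "x \<in> S" and S': "S' \<subseteq> S - {x}"
    and p: "p \<notin> T" "\<And>q. strict_prefix q p \<Longrightarrow> q \<in> T"
    and col: "\<And>q c w. prefix (q @ [c]) p \<Longrightarrow> w \<in> S' \<Longrightarrow> f {v q, x, w} = c"
  shows "colour_tree f V (insert p T) (v(p := x)) S'"
proof -
  note closed = colour_tree_closed[OF tree]
  have xT: "v q \<noteq> x" if "q \<in> T" for q
    using that x colour_tree_disjoint[OF tree] by blast
  have above: "\<not> strict_prefix p u" if "u \<in> T" for u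
    using that closed p(1) by blast
  have above': "\<not> prefix (p @ [c]) u" if "u \<in> T" for u c
    using that above strict_prefix_if_snoc_prefix by metis
  have irr: "\<not> prefix (p @ [c]) p" for c
    by (auto simp: prefix_def)
  have v: "(v(p := x)) q = v q" if "q \<in> T" for q
    using that p(1) by auto
  note c1 = colour_tree_candidate[OF tree] and c2 = colour_tree_triple[OF tree]
  have "\<forall>r\<in>insert p T. \<forall>q. strict_prefix q r \<longrightarrow> q \<in> insert p T"
    using closed p(2) by blast
  moreover have "inj_on (v(p := x)) (insert p T)"
    using colour_tree_inj[OF tree] xT p(1) by (auto simp: inj_on_def)
  moreover have "(v(p := x)) ` insert p T \<subseteq> V" "S' \<subseteq> V" "S' \<inter> (v(p := x)) ` insert p T = {}"
    using colour_tree_subset[OF tree] colour_tree_disjoint[OF tree] x S' p(1) by auto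
  moreover have "\<forall>q\<in>insert p T. \<forall>u\<in>insert p T. \<forall>c. \<forall>w\<in>S'. prefix (q @ [c]) u \<longrightarrow>
      f {(v(p := x)) q, (v(p := x)) u, w} = c"
  proof (intro ballI allI impI)
    fix q u c w
    assume q: "q \<in> insert p T" and u: "u \<in> insert p T" and w: "w \<in> S'" and pre: "prefix (q @ [c]) u"
    have "q \<in> T"
      using q u pre above' irr by blast
    then show "f {(v(p := x)) q, (v(p := x)) u, w} = c"
      using u w pre col[of q c w] c1[of q u w c] v S' by (cases "u = p") auto
  qed
  moreover have "\<forall>q\<in>insert p T. \<forall>u\<in>insert p T. \<forall>r\<in>insert p T. \<forall>c. prefix (q @ [c]) u \<longrightarrow>
      strict_prefix u r \<longrightarrow> f {(v(p := x)) q, (v(p := x)) u, (v(p := x)) r} = c"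
  proof (intro ballI allI impI)
    fix q u r c
    assume q: "q \<in> insert p T" and u: "u \<in> insert p T" and r: "r \<in> insert p T"
      and pre: "prefix (q @ [c]) u" and spre: "strict_prefix u r"
    have uT: "u \<in> T"
      using u r spre above by blast
    have qT: "q \<in> T"
      using q uT pre above' by blast
    show "f {(v(p := x)) q, (v(p := x)) u, (v(p := x)) r} = c"
      using r c1[OF qT uT x pre] c2[OF qT uT _ pre spre] v[OF qT] v[OF uT] v[of r]
      by (cases "r = p") auto
  qed
  ultimately show ?thesis
    unfolding colour_tree_def by blast
qed

section \<open>Homogeneous sets along a branch\<close>

lemma finite_snoc_prefixes: "finite {q. prefix (q @ [c]) p}"
  by (rule finite_subset[OF _ finite_set[of "prefixes p"]])
    (auto dest: append_prefixD)

text \<open>Each occurrence of \<open>c\<close> in \<open>p\<close> corresponds to the ancestor at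
  which that letter was chosen.\<close>

lemma card_snoc_prefixes: "card {q. prefix (q @ [c]) p} = count_list p c"
proof (induction p rule: rev_induct)
  case (snoc d p)
  have eq: "{q. prefix (q @ [c]) (p @ [d])} =
      (if c = d then insert p {q. prefix (q @ [c]) p} else {q. prefix (q @ [c]) p})"
    by auto
  have "p \<notin> {q. prefix (q @ [c]) p}"
    by (auto simp: prefix_def)
  then have "card (insert p {q. prefix (q @ [c]) p}) = Suc (count_list p c)"
    using snoc finite_snoc_prefixes by (subst card_insert_disjoint) auto
  then show ?case
    using snoc unfolding eq by simp
qed auto

lemma colour_tree_homogeneous:
  assumes tree: "colour_tree f V T v S" and p: "p \<in> T"
  obtains H where "H \<subseteq> V" "finite H" "card H = Suc (count_list p c)" "f ` nsets H 3 \<subseteq> {c}"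
proof
  define C where "C = insert p {q. prefix (q @ [c]) p}"
  have CT: "C \<subseteq> T"
    using p by (auto simp: C_def intro!: colour_tree_closed[OF tree p] dest: strict_prefix_if_snoc_prefix)
  have inj: "inj_on v C"
    using colour_tree_inj[OF tree] CT by (rule inj_on_subset)
  have fin: "finite C"
    using finite_snoc_prefixes unfolding C_def by auto
  have "p \<notin> {q. prefix (q @ [c]) p}"
    by (auto simp: prefix_def)
  then have "card C = Suc (count_list p c)"
    using finite_snoc_prefixes[of c p] by (simp add: C_def card_snoc_prefixes)
  then show "card (v ` C) = Suc (count_list p c)"
    using inj by (simp add: card_image)
  show "finite (v ` C)"
    using fin by simp
  show "v ` C \<subseteq> V"
    using colour_tree_subset(1)[OF tree] CT by blast
  \<comment> \<open>Both nodes lie on the branch to \<open>p\<close>. The shorter one is a proper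
    ancestor of \<open>p\<close>, hence leaves towards \<open>p\<close> by \<open>c\<close>, and the
    longer one lies on that same path.\<close>
  have total: "prefix (q @ [c]) u \<or> prefix (u @ [c]) q" if "q \<in> C" "u \<in> C" "q \<noteq> u" for q u
  proof -
    have step: "prefix (q' @ [c]) u'"
      if "prefix (q' @ [c]) p" "prefix u' p" "\<not> prefix u' q'" for q' u'
      using that prefix_same_cases[of "q' @ [c]" p u'] by auto
    have "prefix q p" "prefix u p"
      using that unfolding C_def by (auto dest: append_prefixD)
    then show ?thesis
      using that step unfolding C_def by (metis insert_iff mem_Collect_eq prefix_order.antisym)
  qed
  have key: "f {v q, v u, v r} = c"
    if "q \<in> C" "u \<in> C" "r \<in> C" "prefix (q @ [c]) u" "prefix (u @ [c]) r" for q u r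
    using that CT by (intro colour_tree_triple[OF tree _ _ _ _ strict_prefix_if_snoc_prefix]) auto
  show "f ` nsets (v ` C) 3 \<subseteq> {c}"
  proof clarify
    fix X assume "X \<in> nsets (v ` C) 3"
    then obtain Y where Y: "Y \<in> nsets C 3" "X = v ` Y"
      using nset_image_obtains inj by blast
    then obtain q u r where qur: "Y = {q, u, r}" "q \<noteq> u" "q \<noteq> r" "u \<noteq> r"
      by (auto simp: nsets_def card_3_iff)
    then have C: "q \<in> C" "u \<in> C" "r \<in> C"
      using Y by (auto simp: nsets_def)
    have X: "X = {v q, v u, v r}"
      using Y qur by auto
    \<comment> \<open>\<open>key\<close> needs the three nodes in their order on the branch, which
      \<open>total\<close> determines; all six orders are possible.\<close>
    have perms: "X = {v q, v r, v u}" "X = {v u, v q, v r}" "X = {v u, v r, v q}"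
      "X = {v r, v q, v u}" "X = {v r, v u, v q}"
      using X by auto
    show "f X = c"
      using total[OF C(1) C(2) qur(2)] total[OF C(1) C(3) qur(3)] total[OF C(2) C(3) qur(4)]
        key[OF C(1) C(2) C(3)] key[OF C(1) C(3) C(2)] key[OF C(2) C(1) C(3)]
        key[OF C(2) C(3) C(1)] key[OF C(3) C(1) C(2)] key[OF C(3) C(2) C(1)] X perms
      by metis
  qed
qed

section \<open>Sorting a single vertex\<close>

text \<open>Pigeonhole at every occupied node: if red keeps less than the share
  \<open>\<alpha>\<close> of the candidates, blue keeps at least \<open>1 - \<alpha>\<close>. These
  shares multiply along the walk, which must leave the finite tree.\<close>

lemma descend:
  fixes f :: "'a set \<Rightarrow> nat" and \<alpha> :: real
  assumes "finite T" "finite S" and \<alpha>: "0 \<le> \<alpha>" "\<alpha> \<le> 1"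
    and f: "\<And>q w. q \<in> T \<Longrightarrow> w \<in> S \<Longrightarrow> f {v q, x, w} \<in> {0, 1}"
  obtains p S' where "p \<notin> T" "\<And>q. strict_prefix q p \<Longrightarrow> q \<in> T" "set p \<subseteq> {0, 1}" "S' \<subseteq> S"
    "\<And>q c w. prefix (q @ [c]) p \<Longrightarrow> w \<in> S' \<Longrightarrow> f {v q, x, w} = c"
    "real (card S) * (\<alpha> ^ count_list p 0 * (1 - \<alpha>) ^ count_list p 1) \<le> real (card S')"
proof -
  \<comment> \<open>The walk truncated after \<open>m\<close> steps: it has either stopped at a free
    node or reached depth \<open>m\<close>.\<close>
  have "\<exists>p S'. (p \<notin> T \<or> length p = m) \<and> (\<forall>q. strict_prefix q p \<longrightarrow> q \<in> T) \<and> set p \<subseteq> {0, 1} \<and>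
      S' \<subseteq> S \<and> (\<forall>q c w. prefix (q @ [c]) p \<longrightarrow> w \<in> S' \<longrightarrow> f {v q, x, w} = c) \<and>
      real (card S) * (\<alpha> ^ count_list p 0 * (1 - \<alpha>) ^ count_list p 1) \<le> real (card S')" for m
  proof (induction m)
    case 0
    show ?case
      by (rule exI[of _ "[]"], rule exI[of _ S]) auto
  next
    case (Suc m)
    then obtain p S' where p: "p \<notin> T \<or> length p = m" "\<forall>q. strict_prefix q p \<longrightarrow> q \<in> T"
        "set p \<subseteq> {0, 1}" "S' \<subseteq> S"
        "\<forall>q c w. prefix (q @ [c]) p \<longrightarrow> w \<in> S' \<longrightarrow> f {v q, x, w} = c"
      and card: "real (card S) * (\<alpha> ^ count_list p 0 * (1 - \<alpha>) ^ count_list p 1) \<le> real (card S')"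
      by (elim exE conjE) (rule that)
    show ?case
    proof (cases "p \<in> T")
      case False
      then show ?thesis
        using p card by (intro exI[of _ p] exI[of _ S'] conjI) auto
    next
      case True
      have finS': "finite S'"
        using p(4) \<open>finite S\<close> finite_subset by blast
      define R where "R c = {w \<in> S'. f {v p, x, w} = c}" for c
      have "S' = R 0 \<union> R 1"
        using f[OF True] p(4) unfolding R_def by blast
      moreover have "card (R 0 \<union> R 1) = card (R 0) + card (R 1)"
        using finS' by (intro card_Un_disjoint) (auto simp: R_def)
      ultimately have sum: "real (card S') = real (card (R 0)) + real (card (R 1))"
        by simp
      define \<beta> where "\<beta> c = (if c = 0 then \<alpha> else 1 - \<alpha>)" for c :: nat
      obtain c where c: "c \<in> {0, 1}" "real (card S') * \<beta> c \<le> real (card (R c))"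
      proof (cases "real (card S') * \<alpha> \<le> real (card (R 0))")
        case True
        then show ?thesis using that[of 0] by (simp add: \<beta>_def)
      next
        case False
        then show ?thesis using that[of 1] sum by (simp add: \<beta>_def algebra_simps)
      qed
      have "real (card S) * (\<alpha> ^ count_list (p @ [c]) 0 * (1 - \<alpha>) ^ count_list (p @ [c]) 1) =
          real (card S) * (\<alpha> ^ count_list p 0 * (1 - \<alpha>) ^ count_list p 1) * \<beta> c"
        using c(1) by (auto simp: \<beta>_def)
      also have "\<dots> \<le> real (card S') * \<beta> c"
        using card \<alpha> by (intro mult_right_mono) (auto simp: \<beta>_def)
      also note c(2)
      finally have "real (card S) * (\<alpha> ^ count_list (p @ [c]) 0 * (1 - \<alpha>) ^ count_list (p @ [c]) 1)
          \<le> real (card (R c))" .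
      moreover have "\<forall>q. strict_prefix q (p @ [c]) \<longrightarrow> q \<in> T"
        using p(2) True by (auto simp: strict_prefix_def)
      moreover have "\<forall>q d w. prefix (q @ [d]) (p @ [c]) \<longrightarrow> w \<in> R c \<longrightarrow> f {v q, x, w} = d"
        using p(5) by (auto simp: R_def)
      moreover have "p @ [c] \<notin> T \<or> length (p @ [c]) = Suc m" "set (p @ [c]) \<subseteq> {0, 1}" "R c \<subseteq> S"
        using p True c(1) by (auto simp: R_def)
      ultimately show ?thesis
        by (intro exI[of _ "p @ [c]"] exI[of _ "R c"] conjI)
    qed
  qed
  \<comment> \<open>This depth exceeds that of every occupied node, so the walk has stopped. If
    \<open>T\<close> is empty, \<open>Max\<close> is unspecified, but then every node is
    free.\<close>
  from this[of "Suc (Max (length ` T))"] obtain p S' where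
      p: "p \<notin> T \<or> length p = Suc (Max (length ` T))"
      and rest: "\<forall>q. strict_prefix q p \<longrightarrow> q \<in> T" "set p \<subseteq> {0, 1}" "S' \<subseteq> S"
        "\<forall>q c w. prefix (q @ [c]) p \<longrightarrow> w \<in> S' \<longrightarrow> f {v q, x, w} = c"
        "real (card S) * (\<alpha> ^ count_list p 0 * (1 - \<alpha>) ^ count_list p 1) \<le> real (card S')"
    by (elim exE conjE) (rule that)
  have "p \<notin> T"
    using p \<open>finite T\<close> by (metis Max_ge finite_imageI imageI not_less_eq_eq order_refl)
  then show thesis
    using rest by (intro that) auto
qed

section \<open>Counting the admissible words\<close>

definition colour_words :: "nat \<Rightarrow> nat \<Rightarrow> nat list set" where
  "colour_words a b = {p. set p \<subseteq> {0, 1} \<and> count_list p 0 \<le> a \<and> count_list p 1 \<le> b}"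

lemma length_eq_count_list_add: "set p \<subseteq> {0, 1 :: nat} \<Longrightarrow> length p = count_list p 0 + count_list p 1"
  by (induction p) auto

lemma finite_colour_words: "finite (colour_words a b)"
proof (rule finite_subset)
  show "colour_words a b \<subseteq> {p. set p \<subseteq> {0, 1} \<and> length p \<le> a + b}"
    unfolding colour_words_def using length_eq_count_list_add by fastforce
  show "finite {p. set p \<subseteq> {0, 1 :: nat} \<and> length p \<le> a + b}"
    by (rule finite_lists_length_le) simp
qed

lemma colour_words_Suc_Suc:
  "colour_words (Suc a) (Suc b) =
     insert [] ((#) 0 ` colour_words a (Suc b) \<union> (#) 1 ` colour_words (Suc a) b)"
proof -
  have "p \<in> colour_words (Suc a) (Suc b) \<longleftrightarrow>
     p \<in> insert [] ((#) 0 ` colour_words a (Suc b) \<union> (#) 1 ` colour_words (Suc a) b)" for p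
    by (cases p) (auto simp: colour_words_def)
  then show ?thesis by blast
qed

lemma colour_words_0_Suc: "colour_words 0 (Suc b) = insert [] ((#) 1 ` colour_words 0 b)"
proof -
  have "p \<in> colour_words 0 (Suc b) \<longleftrightarrow> p \<in> insert [] ((#) 1 ` colour_words 0 b)" for p
    by (cases p) (auto simp: colour_words_def)
  then show ?thesis by blast
qed

lemma colour_words_Suc_0: "colour_words (Suc a) 0 = insert [] ((#) 0 ` colour_words a 0)"
proof -
  have "p \<in> colour_words (Suc a) 0 \<longleftrightarrow> p \<in> insert [] ((#) 0 ` colour_words a 0)" for p
    by (cases p) (auto simp: colour_words_def)
  then show ?thesis by blast
qed

lemma colour_words_0_0: "colour_words 0 0 = {[]}"
proof -
  have "p \<in> colour_words 0 0 \<longleftrightarrow> p \<in> {[]}" for p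
    by (cases p) (auto simp: colour_words_def)
  then show ?thesis by blast
qed

text \<open>Splitting off the first letter leaves the empty word over; with one added to each
  cardinality the recursion becomes Pascal's rule.\<close>

lemma card_colour_words: "Suc (card (colour_words a b)) = (a + b + 2) choose (a + 1)"
proof (induction "a + b" arbitrary: a b)
  case 0
  then show ?case by (simp add: colour_words_0_0)
next
  case (Suc m)
  have cons: "card ((#) c ` W) = card W" for c and W :: "nat list set"
    by (rule card_image) auto
  show ?case
  proof (cases a; cases b)
    fix a' b' assume ab: "a = Suc a'" "b = Suc b'"
    have "card ((#) 0 ` colour_words a' b \<union> (#) 1 ` colour_words a b') =
        card (colour_words a' b) + card (colour_words a b')"
      by (subst card_Un_disjoint) (auto simp: cons finite_colour_words)
    then have "card (colour_words a b) = Suc (card (colour_words a' b) + card (colour_words a b'))"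
      unfolding ab colour_words_Suc_Suc
      by (subst card_insert_disjoint) (auto simp: finite_colour_words)
    then show ?thesis
      using Suc(1)[of a' b] Suc(1)[of a b'] Suc(2) ab by simp
  next
    fix b' assume ab: "a = 0" "b = Suc b'"
    have "card (colour_words a b) = Suc (card (colour_words 0 b'))"
      unfolding ab colour_words_0_Suc
      by (subst card_insert_disjoint) (auto simp: finite_colour_words cons)
    then show ?thesis
      using Suc(1)[of 0 b'] Suc(2) ab by simp
  next
    fix a' assume ab: "a = Suc a'" "b = 0"
    have "card (colour_words a b) = Suc (card (colour_words a' 0))"
      unfolding ab colour_words_Suc_0
      by (subst card_insert_disjoint) (auto simp: finite_colour_words cons)
    then show ?thesis
      using Suc(1)[of a' 0] Suc(2) ab by (simp add: binomial_symmetric)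
  next
    assume "a = 0" "b = 0"
    then show ?thesis using Suc(2) by simp
  qed
qed

section \<open>From the sorting procedure to a bound on \<open>r\<^sub>3\<close>\<close>

text \<open>Induction on the number of free words. A word of \<open>colour_words a b\<close> keeps
  at least the share \<open>\<alpha> ^ a * (1 - \<alpha>) ^ b\<close> of the candidates, and
  removing the sorted vertex costs at most a factor 2. So each free word is paid for by one factor
  of \<open>large\<close>, until a vertex is sorted to a word outside.\<close>

lemma colour_tree_monochromatic:
  fixes f :: "'a set \<Rightarrow> nat" and \<alpha> :: real
  assumes V: "finite V" and f: "f \<in> nsets V 3 \<rightarrow> {..<2}" and \<alpha>: "0 < \<alpha>" "\<alpha> < 1"
    and tree: "colour_tree f V T v S" and T: "T \<subseteq> colour_words a b"
    and large: "2 * (2 / (\<alpha> ^ a * (1 - \<alpha>) ^ b)) ^ card (colour_words a b - T) \<le> real (card S)"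
  shows "monochromatic V (a + 3) 3 f 0 \<or> monochromatic V (b + 3) 3 f 1"
  using tree T large
proof (induction "card (colour_words a b - T)" arbitrary: T v S rule: less_induct)
  case less
  define g where "g = \<alpha> ^ a * (1 - \<alpha>) ^ b"
  have g: "0 < g" "g \<le> 1"
    using \<alpha> by (auto simp: g_def intro!: mult_le_one power_le_one)
  \<comment> \<open>The leading 2 in \<open>large\<close> leaves two candidates even when no word is
    free: one to be sorted, one to extend the branch below it.\<close>
  have "1 \<le> (2 / g) ^ card (colour_words a b - T)"
    using g by (intro one_le_power) (auto simp: field_simps)
  then have S2: "2 \<le> real (card S)"
    using less.prems(3) unfolding g_def by linarith
  have SV: "S \<subseteq> V" "v ` T \<subseteq> V" "S \<inter> v ` T = {}"
    using colour_tree_subset[OF less.prems(1)] colour_tree_disjoint[OF less.prems(1)] by auto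
  have finS: "finite S"
    using SV(1) V by (rule finite_subset)
  have finT: "finite T"
    using less.prems(2) finite_colour_words by (rule finite_subset)
  obtain x where x: "x \<in> S"
    using S2 by fastforce
  have cardS: "real (card (S - {x})) = real (card S) - 1"
    using x finS S2 by (simp add: of_nat_diff)
  have f01: "f {v q, x, w} \<in> {0, 1}" if "q \<in> T" "w \<in> S - {x}" for q w
  proof -
    have "v q \<in> V" "v q \<notin> S"
      using that SV by blast+
    then have "v q \<noteq> x" "v q \<noteq> w" "x \<noteq> w"
      using that x by auto
    then have "{v q, x, w} \<in> nsets V 3"
      using \<open>v q \<in> V\<close> that x SV by (auto simp: nsets_def)
    then have "f {v q, x, w} < 2"
      using f by blast
    then show ?thesis by auto
  qed
  obtain p S' where p: "p \<notin> T" "\<And>q. strict_prefix q p \<Longrightarrow> q \<in> T" "set p \<subseteq> {0, 1}"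
    and S': "S' \<subseteq> S - {x}" and col: "\<And>q c w. prefix (q @ [c]) p \<Longrightarrow> w \<in> S' \<Longrightarrow> f {v q, x, w} = c"
    and card: "real (card (S - {x})) * (\<alpha> ^ count_list p 0 * (1 - \<alpha>) ^ count_list p 1) \<le> real (card S')"
    by (rule descend[where f = f and v = v and x = x and S = "S - {x}", OF finT finite_Diff[OF finS]
      less_imp_le[OF \<alpha>(1)] less_imp_le[OF \<alpha>(2)] f01]) (assumption+, rule that)
  have tree': "colour_tree f V (insert p T) (v(p := x)) S'"
    using colour_tree_insert[OF less.prems(1) x S' p(1,2) col] .
  show ?case
  proof (cases "p \<in> colour_words a b")
    case True
    have smaller: "card (colour_words a b - T) = Suc (card (colour_words a b - insert p T))"
      using True p(1) finite_colour_words[of a b]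
      by (metis DiffI Diff_insert card_Suc_Diff1 finite_Diff)
    have "g \<le> \<alpha> ^ count_list p 0 * (1 - \<alpha>) ^ count_list p 1"
      using True \<alpha> unfolding g_def colour_words_def
      by (intro mult_mono power_decreasing) auto
    \<comment> \<open>From \<open>card S \<ge> 2\<close> follows
      \<open>card S - 1 \<ge> card S / 2\<close>.\<close>
    then have "(real (card S) / 2) * g \<le>
        real (card (S - {x})) * (\<alpha> ^ count_list p 0 * (1 - \<alpha>) ^ count_list p 1)"
      using S2 g cardS by (intro mult_mono) auto
    moreover have "2 * (2 / g) ^ card (colour_words a b - insert p T) \<le> (real (card S) / 2) * g"
      using less.prems(3) g unfolding g_def[symmetric] smaller by (simp add: field_simps)
    ultimately have "2 * (2 / g) ^ card (colour_words a b - insert p T) \<le> real (card S')"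
      using card by linarith
    then show ?thesis
      using less.hyps[OF _ tree'] smaller True less.prems(2) unfolding g_def by simp
  next
    case False
    define bd where "bd c = (if c = 0 then a else b)" for c :: nat
    obtain c where c: "c \<in> {0, 1}" "bd c < count_list p c"
      using False p(3) unfolding colour_words_def bd_def by fastforce
    \<comment> \<open>Both shares are positive, so a candidate survives the walk. It is needed
      because the node \<open>p\<close> alone guarantees only \<open>bd c + 2\<close>
      vertices.\<close>
    have "0 < real (card (S - {x})) * (\<alpha> ^ count_list p 0 * (1 - \<alpha>) ^ count_list p 1)"
      using S2 cardS \<alpha> by simp
    then have "0 < card S'"
      using card by linarith
    then obtain w where w: "w \<in> S'"
      by fastforce
    \<comment> \<open>Placing a remaining candidate below \<open>p\<close> lengthens the homogeneous set by one more vertex.\<close>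
    have new: "p @ [c] \<notin> insert p T"
      using p(1) colour_tree_closed[OF less.prems(1), of "p @ [c]" p] by (auto simp: strict_prefix_def)
    have anc: "q \<in> insert p T" if "strict_prefix q (p @ [c])" for q
      using that p(2) by (auto simp: strict_prefix_def)
    have "colour_tree f V (insert (p @ [c]) (insert p T)) ((v(p := x))(p @ [c] := w)) {}"
      using colour_tree_insert[OF tree' w _ new anc, of "{}"] by simp
    then obtain H where H: "H \<subseteq> V" "finite H" "card H = Suc (count_list (p @ [c]) c)"
      "f ` nsets H 3 \<subseteq> {c}"
      using colour_tree_homogeneous[of f V _ _ _ "p @ [c]" c] by blast
    then have "bd c + 3 \<le> card H"
      using c(2) by simp
    then obtain G where G: "G \<subseteq> H" "card G = bd c + 3" "finite G"
      by (rule obtain_subset_with_card_n)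
    have "G \<in> nsets V (bd c + 3)"
      using G H(1) by (auto simp: nsets_def)
    moreover have "f ` nsets G 3 \<subseteq> {c}"
      using H(4) nsets_mono[OF G(1), of 3] by blast
    ultimately have "monochromatic V (bd c + 3) 3 f c"
      unfolding monochromatic_def by blast
    then show ?thesis
      using c(1) by (auto simp: bd_def)
  qed
qed

text \<open>Sorting starts from the empty tree with all \<open>N\<close> vertices as candidates, so
  that every word is still free.\<close>

lemma ramsey3_le:
  fixes \<alpha> :: real
  assumes \<alpha>: "0 < \<alpha>" "\<alpha> < 1"
    and N: "2 * (2 / (\<alpha> ^ a * (1 - \<alpha>) ^ b)) ^ card (colour_words a b) \<le> real N"
  shows "r\<^sub>3 (a + 3) (b + 3) \<le> N"
  unfolding ramsey3_def
proof (rule Least_le, unfold partn_lst_def, rule ballI)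
  fix f assume "f \<in> nsets {..<N} 3 \<rightarrow> {..<length [a + 3, b + 3]}"
  then have f: "f \<in> nsets {..<N} 3 \<rightarrow> {..<2}"
    by (simp add: numeral_2_eq_2)
  have "colour_tree f {..<N} {} (\<lambda>_. 0) {..<N}"
    by (simp add: colour_tree_def)
  from colour_tree_monochromatic[OF _ f \<alpha> this, of a b]
  have "monochromatic {..<N} (a + 3) 3 f 0 \<or> monochromatic {..<N} (b + 3) 3 f 1"
    using N by simp
  then show "\<exists>i<length [a + 3, b + 3]. monochromatic {..<N} ([a + 3, b + 3] ! i) 3 f i"
    by (auto simp: less_Suc_eq)
qed

section \<open>Logarithms and the limit for fixed \<open>s\<close>\<close>

lemma ln_ramsey3_le:
  "ln (real (r\<^sub>3 (a + 3) (b + 3))) \<le>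
     ln 3 + real ((a + b + 2) choose (a + 1)) * (ln 2 + 1 + real a * ln (real (b + 3)))"
proof -
  \<comment> \<open>With \<open>n = b + 3\<close>, a red step costs \<open>ln n\<close>, whereas all
    blue steps to one word together cost at most \<open>b / (n - 1)\<close>, which is below
    1.\<close>
  define \<alpha> where "\<alpha> = 1 / real (b + 3)"
  have \<alpha>: "0 < \<alpha>" "\<alpha> < 1"
    by (auto simp: \<alpha>_def)
  define g where "g = \<alpha> ^ a * (1 - \<alpha>) ^ b"
  have g: "0 < g" "g \<le> 1"
    using \<alpha> by (auto simp: g_def intro!: mult_le_one power_le_one)
  define k where "k = card (colour_words a b)"
  define M where "M = (2 / g) ^ k"
  have M: "1 \<le> M"
    using g unfolding M_def by (intro one_le_power) (auto simp: field_simps)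
  have "2 * M \<le> real (nat \<lceil>2 * M\<rceil>)"
    by linarith
  then have "r\<^sub>3 (a + 3) (b + 3) \<le> nat \<lceil>2 * M\<rceil>"
    using ramsey3_le[OF \<alpha>] unfolding M_def g_def k_def by blast
  \<comment> \<open>Rounding \<open>2 * M\<close> up adds less than 1, and
    \<open>1 \<le> M\<close>.\<close>
  then have r: "real (r\<^sub>3 (a + 3) (b + 3)) \<le> 3 * M"
    using M by linarith
  have "ln (real (r\<^sub>3 (a + 3) (b + 3))) \<le> ln (3 * M)"
  \<comment> \<open>The value 0 is treated apart, with \<open>ln 0 = 0\<close>, because monotonicity
    of \<open>ln\<close> needs a positive argument.\<close>
  proof (cases "r\<^sub>3 (a + 3) (b + 3) = 0")
    case True
    then show ?thesis using M by simp
  next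
    case False
    then show ?thesis using r M by (intro ln_mono) auto
  qed
  also have "\<dots> = ln 3 + real k * (ln 2 - ln g)"
    using M g unfolding M_def by (simp add: ln_mult ln_realpow ln_div)
  also have "\<dots> \<le> ln 3 + real k * (ln 2 + 1 + real a * ln (real (b + 3)))"
  proof -
    have ln_g: "- ln g = real a * ln (real (b + 3)) + real b * ln (1 / (1 - \<alpha>))"
      using \<alpha> unfolding g_def by (simp add: ln_mult ln_realpow ln_div \<alpha>_def)
    have "ln (1 / (1 - \<alpha>)) \<le> 1 / (1 - \<alpha>) - 1"
      using \<alpha> by (intro ln_le_minus_one) auto
    also have "\<dots> = 1 / real (b + 2)"
      by (simp add: \<alpha>_def field_simps)
    finally have "real b * ln (1 / (1 - \<alpha>)) \<le> real b * (1 / real (b + 2))"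
      by (intro mult_left_mono) auto
    also have "\<dots> \<le> 1"
      by (simp add: field_simps)
    finally have "real b * ln (1 / (1 - \<alpha>)) \<le> 1" .
    with ln_g show ?thesis
      by (intro add_left_mono mult_left_mono) auto
  qed
  also have "real k * (ln 2 + 1 + real a * ln (real (b + 3))) \<le>
      real ((a + b + 2) choose (a + 1)) * (ln 2 + 1 + real a * ln (real (b + 3)))"
    using card_colour_words[of a b] unfolding k_def
    by (intro mult_right_mono) (auto intro!: add_nonneg_nonneg)
  finally show ?thesis
    by simp
qed

theorem theorem1p2:
  fixes s :: nat
  assumes "s \<ge> 4"
  shows "\<exists>\<epsilon> :: nat \<Rightarrow> real. \<epsilon> \<longlonglongrightarrow> 0 \<and>
    (\<forall>\<^sub>F n in sequentially.
       ln (real (r\<^sub>3 s n)) \<le> (real (s - 3) / fact (s - 2) + \<epsilon> n) * real n ^ (s - 2) * ln (real n))"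
proof -
  define d where "d = s - 2"
  define C :: real where "C = real (s - 3) / fact d"
  \<comment> \<open>This is the bound of \<open>ln_ramsey3_le\<close> divided by
    \<open>n ^ d * ln n\<close>, with the binomial coefficient replaced by
    \<open>(n + d) ^ d / fact d\<close>. It tends to \<open>C\<close>, so
    \<open>\<delta> n - C\<close> serves as the error term.\<close>
  define \<delta> where "\<delta> n = ln 3 / (real n ^ d * ln (real n)) +
      (1 + real d / real n) ^ d / fact d * ((ln 2 + 1) / ln (real n) + real (s - 3))" for n
  have d: "d > 0" "s - 3 + 1 = d"
    using assms by (auto simp: d_def)
  have ln_inf: "filterlim (\<lambda>n. ln (real n)) at_top sequentially"
    by (rule filterlim_compose[OF ln_at_top filterlim_real_sequentially])
  have "filterlim (\<lambda>n. real n ^ d * ln (real n)) at_top sequentially"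
    using filterlim_pow_at_top[OF d(1) filterlim_real_sequentially] ln_inf
    by (rule filterlim_at_top_mult_at_top)
  then have 1: "(\<lambda>n. ln 3 / (real n ^ d * ln (real n))) \<longlonglongrightarrow> 0"
    by (intro tendsto_divide_0[OF tendsto_const] filterlim_at_top_imp_at_infinity)
  have 2: "(\<lambda>n. (ln 2 + 1) / ln (real n)) \<longlonglongrightarrow> 0"
    using ln_inf by (intro tendsto_divide_0[OF tendsto_const] filterlim_at_top_imp_at_infinity)
  have "\<delta> \<longlonglongrightarrow> 0 + (1 + 0) ^ d / fact d * (0 + real (s - 3))"
    unfolding \<delta>_def by (intro tendsto_intros 1 2 lim_const_over_n) auto
  then have lim: "(\<lambda>n. \<delta> n - C) \<longlonglongrightarrow> 0"
    by (simp add: C_def LIM_zero_iff)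
  have "ln (real (r\<^sub>3 s n)) \<le> (C + (\<delta> n - C)) * real n ^ d * ln (real n)" if n: "n \<ge> 3" for n
  proof -
    have ln_pos: "0 < ln (real n)"
      using n by (intro ln_gt_zero) simp
    have "real ((s - 3 + (n - 3) + 2) choose d) * fact d \<le> (real n + real d) ^ d"
    proof -
      have "((s - 3 + (n - 3) + 2) choose d) * fact d \<le> (s - 3 + (n - 3) + 2) ^ d"
        by (rule binomial_fact_pow)
      also have "\<dots> \<le> (n + d) ^ d"
        \<comment> \<open>The upper index is \<open>n + s - 4\<close>, which is
          \<open>n + d - 2\<close>.\<close>
        using n assms by (intro power_mono) (auto simp: d_def)
      finally show ?thesis
        by (metis of_nat_add of_nat_fact of_nat_le_iff of_nat_mult of_nat_power)
    qed
    also have "real n + real d = real n * (1 + real d / real n)"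
      using n by (simp add: distrib_left)
    finally have choose: "real ((s - 3 + (n - 3) + 2) choose d) \<le>
        real n ^ d * (1 + real d / real n) ^ d / fact d"
      by (simp add: pos_le_divide_eq power_mult_distrib)
    have "ln (real (r\<^sub>3 s n)) \<le> ln 3 +
        real ((s - 3 + (n - 3) + 2) choose d) * (ln 2 + 1 + real (s - 3) * ln (real n))"
      using ln_ramsey3_le[of "s - 3" "n - 3"] n assms unfolding d(2) by simp
    also have "\<dots> \<le> ln 3 +
        real n ^ d * (1 + real d / real n) ^ d / fact d * (ln 2 + 1 + real (s - 3) * ln (real n))"
      using ln_pos by (intro add_left_mono mult_right_mono[OF choose]) (auto intro!: add_nonneg_nonneg)
    also have "\<dots> = \<delta> n * (real n ^ d * ln (real n))"
    proof -
      have "l + X * A / F * (K + m * L) = (l / (X * L) + A / F * (K / L + m)) * (X * L)"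
        if "X > 0" "L > 0" "F > 0" for l X A F K m L :: real
        using that by (simp add: field_simps)
      then show ?thesis
        using ln_pos n unfolding \<delta>_def by simp
    qed
    finally show ?thesis by (simp add: mult.assoc)
  qed
  then have "\<forall>\<^sub>F n in sequentially.
      ln (real (r\<^sub>3 s n)) \<le> (C + (\<delta> n - C)) * real n ^ d * ln (real n)"
    by (rule eventually_sequentiallyI)
  with lim show ?thesis
    unfolding C_def d_def by blast
qed

end
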